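(* Let $\mathbf{F}_q$ be a finite field with $q$ elements and let $f\in MF_n^n(\mathbf{F}_q)$ be a monomial dynamical system. Then $f$ is a fixed point system with $(1,\dots,1)^t\in\mathbf{F}_q^n$ as its only fixed point if and only if the dependency graph of $f$ contains only trivial strongly connected components.
   Context: $E_q=\{0,1,\dots,q-1\}$; convention $x^0=1$ for all $x\in\mathbf{F}_q$. A monomial dynamical system $f\in MF_n^n(\mathbf{F}_q)$ ($n$ a positive integer) is a map $f:\mathbf{F}_q^n\to\mathbf{F}_q^n$ for which there is a (necessarily unique) $n\times n$ matrix $F$ with entries in $E_q$, called the corresponding matrix of $f$, such that $f_i(x)=x_1^{F_{i1}}\cdots x_n^{F_{in}}$ for all $x\in\mathbf{F}_q^n$ and all $i$. $f$ is a fixed point system if every trajectory $x,f(x),f^2(x),\dots$ ends in a fixed point of $f$; equivalently there is $m\ge 1$ with $f^{m+\lambda}=f^m$ for all $\lambda\ge 1$. The dependency graph of $f$ is the directed multigraph (self loops and parallel edges allowed) with vertices $a_1,\dots,a_n$ and exactly $F_{ij}$ directed edges from $a_i$ to $a_j$ for all $i,j$. Strongly connected components are the usual ones (every vertex is connected to itself by the empty sequence of length $0$). A strongly connected component is trivial if it consists of a single vertex $a$ and there is no edge $a\to a$. *)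

theory Defs
  imports
    "HOL-Analysis.Finite_Cartesian_Product"
    "HOL-Computational_Algebra.Polynomial"
    "Graph_Theory.Digraph_Component"
begin

text \<open>
  The finite field with \<open>q\<close> elements is a type \<open>'a :: {field, finite}\<close> with \<open>q = CARD('a)\<close>, and
  \<open>n = CARD('n)\<close>. The convention \<open>0 ^ 0 = 1\<close> holds for the library power function.
\<close>

definition is_corresponding_matrix ::
    "nat ^ 'n ^ 'n \<Rightarrow> ('a :: {field, finite} ^ 'n \<Rightarrow> 'a ^ 'n) \<Rightarrow> bool" where
  "is_corresponding_matrix F f \<longleftrightarrow>
     (\<forall>i j. F $ i $ j \<in> {0..<CARD('a)}) \<and>
     (\<forall>x i. f x $ i = (\<Prod>j\<in>UNIV. (x $ j) ^ (F $ i $ j)))"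

definition monomial_system :: "('a :: {field, finite} ^ 'n \<Rightarrow> 'a ^ 'n) \<Rightarrow> bool" where
  "monomial_system f \<longleftrightarrow> (\<exists>F. is_corresponding_matrix F f)"

text \<open>Meaningful only for monomial systems; uniqueness is shown below.\<close>

definition corresponding_matrix :: "('a :: {field, finite} ^ 'n \<Rightarrow> 'a ^ 'n) \<Rightarrow> nat ^ 'n ^ 'n" where
  "corresponding_matrix f = (THE F. is_corresponding_matrix F f)"

definition fixed_point_system :: "('b \<Rightarrow> 'b) \<Rightarrow> bool" where
  "fixed_point_system f \<longleftrightarrow> (\<forall>x. \<exists>m. f ((f ^^ m) x) = (f ^^ m) x)"

text \<open>The arc \<open>(i, j, k)\<close> is the \<open>k\<close>-th of the \<open>F $ i $ j\<close> parallel edges from \<open>i\<close> to \<open>j\<close>.\<close>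

definition dependency_graph ::
    "('a :: {field, finite} ^ 'n \<Rightarrow> 'a ^ 'n) \<Rightarrow> ('n, 'n \<times> 'n \<times> nat) pre_digraph" where
  "dependency_graph f =
     \<lparr> verts = UNIV,
       arcs = {(i, j, k). k < corresponding_matrix f $ i $ j},
       tail = (\<lambda>(i, j, k). i),
       head = (\<lambda>(i, j, k). j) \<rparr>"

definition trivial_component :: "('v, 'e) pre_digraph \<Rightarrow> ('v, 'e) pre_digraph \<Rightarrow> bool" where
  "trivial_component G H \<longleftrightarrow> (\<exists>a. verts H = {a} \<and> \<not> a \<rightarrow>\<^bsub>G\<^esub> a)"

lemma power_fun_eq_imp_eq:
  fixes a b :: nat
  assumes eq: "\<And>t :: 'a :: {field, finite}. t ^ a = t ^ b"
    and "a < CARD('a)" "b < CARD('a)"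
  shows "a = b"
proof (rule ccontr)
  assume "a \<noteq> b"
  define p :: "'a poly" where "p = monom 1 a - monom 1 b"
  have "coeff p a = 1"
    using \<open>a \<noteq> b\<close> by (simp add: p_def)
  hence "p \<noteq> 0"
    by auto
  have "degree p < CARD('a)"
    unfolding p_def using assms(2,3) by (intro degree_diff_less) (simp_all add: degree_monom_eq)
  moreover have "{x. poly p x = 0} = UNIV"
    by (auto simp: p_def poly_monom eq)
  ultimately show False
    using card_poly_roots_bound[OF \<open>p \<noteq> 0\<close>] by simp
qed

lemma is_corresponding_matrix_unique:
  fixes f :: "'a :: {field, finite} ^ 'n \<Rightarrow> 'a ^ 'n"
  assumes F: "is_corresponding_matrix F f" and G: "is_corresponding_matrix G f"
  shows "F = G"
proof -
  have "F $ i $ j = G $ i $ j" for i j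
  proof (rule power_fun_eq_imp_eq[where 'a = 'a])
    fix t :: 'a
    define x :: "'a ^ 'n" where "x = (\<chi> k. if k = j then t else 1)"
    have "(\<Prod>k\<in>UNIV. (x $ k) ^ (H $ i $ k)) = t ^ (H $ i $ j)" for H :: "nat ^ 'n ^ 'n"
    proof -
      have "(\<Prod>k\<in>UNIV. (x $ k) ^ (H $ i $ k)) = (\<Prod>k\<in>UNIV. if k = j then t ^ (H $ i $ k) else 1)"
        by (intro prod.cong) (auto simp: x_def)
      thus ?thesis
        by simp
    qed
    thus "t ^ (F $ i $ j) = t ^ (G $ i $ j)"
      using F G unfolding is_corresponding_matrix_def by metis
  qed (use F G in \<open>auto simp: is_corresponding_matrix_def\<close>)
  thus ?thesis
    by (simp add: vec_eq_iff)
qed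

lemma corresponding_matrix_eq:
  "is_corresponding_matrix F f \<Longrightarrow> corresponding_matrix f = F"
  unfolding corresponding_matrix_def by (blast intro: is_corresponding_matrix_unique)

lemma wf_digraph_dependency_graph: "wf_digraph (dependency_graph f)"
  by unfold_locales (simp_all add: dependency_graph_def)

end

theory Submission
  imports Defs
begin

text \<open>
  All strongly connected components are trivial iff the dependency graph is acyclic. If it is
  acyclic, then its edge relation on the finite vertex set is well-founded, and by well-founded
  induction each coordinate of a trajectory is eventually \<open>1\<close>, since \<open>f\<^sub>i\<close> depends only on the
  successors of \<open>i\<close>. If there is a cycle, then the trajectory of the zero vector vanishes forever
  on the vertices lying on cycles, so it never reaches \<open>(1, \<dots>, 1)\<close>.
\<close>

lemma (in wf_digraph) all_sccs_trivial_iff_acyclic: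
  "(\<forall>H \<in> sccs. trivial_component G H) \<longleftrightarrow> acyclic (arcs_ends G)"
proof -
  have "(\<forall>H \<in> sccs. trivial_component G H) \<longleftrightarrow>
      (\<forall>S \<in> verts ` sccs. \<exists>a. S = {a} \<and> \<not> a \<rightarrow> a)"
    by (simp add: trivial_component_def)
  \<comment> \<open>Triviality depends only on the vertex set of \<open>H\<close>, and these sets
    are exactly the classes \<open>scc_of u\<close>.\<close>
  also have "\<dots> \<longleftrightarrow> (\<forall>u \<in> verts G. \<exists>a. scc_of u = {a} \<and> \<not> a \<rightarrow> a)"
    by (simp add: sccs_verts_conv_scc_of flip: sccs_verts_conv)
  also have "\<dots> \<longleftrightarrow> acyclic (arcs_ends G)"
  proof
    assume triv: "\<forall>u \<in> verts G. \<exists>a. scc_of u = {a} \<and> \<not> a \<rightarrow> a"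
    show "acyclic (arcs_ends G)"
    proof (rule acyclicI, intro allI notI)
      fix u assume "u \<rightarrow>\<^sup>+ u"
      \<comment> \<open>The first step of the cycle stays in the component of \<open>u\<close>. As
        that is a singleton, \<open>v = u\<close>, and the edge becomes a forbidden self
        loop.\<close>
      then obtain v where uv: "u \<rightarrow> v" and vu: "(v, u) \<in> (arcs_ends G)\<^sup>*"
        by (auto dest: tranclD)
      have u: "u \<in> verts G" and v: "v \<in> verts G"
        using uv by (auto dest: adj_in_verts)
      have "v \<rightarrow>\<^sup>* u"
        using vu v by (auto simp: rtrancl_eq_or_trancl)
      with uv have "v \<in> scc_of u"
        by (auto simp: scc_of_def)
      moreover have "u \<in> scc_of u"
        using u by (rule in_scc_of_self)
      ultimately show False
        using triv u uv by fastforce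
    qed
  next
    assume acyc: "acyclic (arcs_ends G)"
    show "\<forall>u \<in> verts G. \<exists>a. scc_of u = {a} \<and> \<not> a \<rightarrow> a"
    proof (intro ballI exI conjI)
      fix u assume u: "u \<in> verts G"
      show "\<not> u \<rightarrow> u"
        using acyc by (auto simp: acyclic_def)
      \<comment> \<open>Distinct mutually reachable vertices would give a closed walk of positive
        length at \<open>u\<close>.\<close>
      have "v = u" if "u \<rightarrow>\<^sup>* v" "v \<rightarrow>\<^sup>* u" for v
        using acyc that reachable_neq_reachable1 reachable1_reachable_trans
        unfolding acyclic_def by metis
      with in_scc_of_self[OF u] show "scc_of u = {u}"
        by (auto simp: scc_of_def)
    qed
  qed
  finally show ?thesis .
qed

lemma adj_dependency_graph_iff:
  assumes "is_corresponding_matrix F f"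
  shows "i \<rightarrow>\<^bsub>dependency_graph f\<^esub> j \<longleftrightarrow> F $ i $ j > 0"
  by (force simp: dependency_graph_def arcs_ends_def arc_to_ends_def
      corresponding_matrix_eq[OF assms])

text \<open>Each coordinate in \<open>S\<close> has a factor from \<open>S\<close> with positive
  exponent, so zeros on \<open>S\<close> reproduce themselves at every step. The exponent must be
  positive because \<open>0 ^ 0 = 1\<close>.\<close>

lemma trajectory_of_zero_vanishes:
  assumes F: "is_corresponding_matrix F f"
    and succ: "\<And>i. i \<in> S \<Longrightarrow> \<exists>j \<in> S. F $ i $ j > 0"
    and "i \<in> S"
  shows "(f ^^ m) 0 $ i = 0"
  using \<open>i \<in> S\<close>
proof (induction m arbitrary: i)
  case (Suc m)
  from succ[OF Suc.prems] obtain j where "j \<in> S" "F $ i $ j > 0"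
    by blast
  with Suc.IH[of j] have "((f ^^ m) 0 $ j) ^ (F $ i $ j) = 0"
    by simp
  then show ?case
    using F by (auto simp: is_corresponding_matrix_def intro!: prod_zero)
qed simp

lemma eventually_trajectory_coordinate_one:
  fixes f :: "'a :: {field, finite} ^ 'n \<Rightarrow> 'a ^ 'n"
  assumes F: "is_corresponding_matrix F f"
    and acyc: "acyclic (arcs_ends (dependency_graph f))"
  shows "\<forall>\<^sub>F m in sequentially. (f ^^ m) x $ i = 1"
proof -
  \<comment> \<open>The converse relation lets the induction pass from the successors of a vertex to
    the vertex itself.\<close>
  have "wf ((arcs_ends (dependency_graph f))\<inverse>)"
    using acyc by (intro finite_acyclic_wf_converse) auto
  then show ?thesis
  proof (induction i rule: wf_induct_rule)
    case (less i)
    have "\<forall>\<^sub>F m in sequentially. ((f ^^ m) x $ j) ^ (F $ i $ j) = 1" for j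
    \<comment> \<open>With exponent \<open>0\<close> the factor is \<open>1\<close> whatever the
      coordinate is; otherwise \<open>j\<close> is a successor of \<open>i\<close>.\<close>
    proof (cases "F $ i $ j = 0")
      case False
      then have "\<forall>\<^sub>F m in sequentially. (f ^^ m) x $ j = 1"
        by (intro less) (simp add: adj_dependency_graph_iff[OF F])
      then show ?thesis
        by eventually_elim simp
    qed simp
    then have "\<forall>\<^sub>F m in sequentially. \<forall>j. ((f ^^ m) x $ j) ^ (F $ i $ j) = 1"
      by (rule eventually_all_finite)
    then have "\<forall>\<^sub>F m in sequentially. (f ^^ Suc m) x $ i = 1"
      by eventually_elim (use F in \<open>simp add: is_corresponding_matrix_def\<close>)
    then show ?case
      by - (rule eventually_sequentially_Suc[THEN iffD1])
  qed
qed

theorem theorem29: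
  fixes f :: "'a :: {field, finite} ^ 'n \<Rightarrow> 'a ^ 'n"
  assumes "monomial_system f"
  shows "(fixed_point_system f \<and> {x. f x = x} = {\<chi> i. 1}) \<longleftrightarrow>
         (\<forall>H \<in> pre_digraph.sccs (dependency_graph f). trivial_component (dependency_graph f) H)"
proof -
  obtain F where F: "is_corresponding_matrix F f"
    using assms by (auto simp: monomial_system_def)
  let ?E = "arcs_ends (dependency_graph f)"
  have "(fixed_point_system f \<and> {x. f x = x} = {\<chi> i. 1}) \<longleftrightarrow> acyclic ?E"
  proof
    assume fps: "fixed_point_system f \<and> {x. f x = x} = {\<chi> i. 1}"
    then obtain m where "f ((f ^^ m) 0) = (f ^^ m) 0"
      by (auto simp: fixed_point_system_def)
    with fps have one: "(f ^^ m) 0 = (\<chi> i. 1)"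
      by blast
    show "acyclic ?E"
    proof (rule acyclicI, intro allI notI)
      fix v assume v: "(v, v) \<in> ?E\<^sup>+"
      \<comment> \<open>Rotating a cycle through \<open>i\<close> by one edge shows that the next
        vertex also lies on a cycle.\<close>
      have "\<exists>j \<in> {u. (u, u) \<in> ?E\<^sup>+}. F $ i $ j > 0" if "i \<in> {u. (u, u) \<in> ?E\<^sup>+}" for i
      proof -
        from that obtain j where ij: "(i, j) \<in> ?E" and "(j, i) \<in> ?E\<^sup>*"
          by (auto dest: tranclD)
        then have "(j, j) \<in> ?E\<^sup>+"
          by simp
        with ij show ?thesis
          by (auto simp: adj_dependency_graph_iff[OF F])
      qed
      then have "(f ^^ m) 0 $ v = 0"
        using v by (intro trajectory_of_zero_vanishes[OF F, where S = "{u. (u, u) \<in> ?E\<^sup>+}"]) auto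
      with one show False
        by simp
    qed
  next
    assume acyc: "acyclic ?E"
    have reaches_one: "\<exists>m. (f ^^ m) x = (\<chi> i. 1)" for x
    proof -
      \<comment> \<open>Finitely many coordinates admit a common time \<open>m\<close>.\<close>
      have "\<forall>\<^sub>F m in sequentially. \<forall>i. (f ^^ m) x $ i = 1"
        by (intro eventually_all_finite eventually_trajectory_coordinate_one[OF F acyc])
      then show ?thesis
        by (auto simp: vec_eq_iff eventually_sequentially)
    qed
    have one_fixed: "f (\<chi> i. 1) = (\<chi> i. 1)"
      using F by (simp add: is_corresponding_matrix_def vec_eq_iff)
    \<comment> \<open>The trajectory of a fixed point is constant, yet it reaches the all-ones
      vector.\<close>
    have "x = (\<chi> i. 1)" if "f x = x" for x
    proof -
      have "(f ^^ m) x = x" for m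
        by (induction m) (simp_all add: that)
      with reaches_one[of x] show ?thesis
        by simp
    qed
    with one_fixed have "{x. f x = x} = {\<chi> i. 1}"
      by blast
    moreover have "fixed_point_system f"
      unfolding fixed_point_system_def using reaches_one one_fixed by metis
    ultimately show "fixed_point_system f \<and> {x. f x = x} = {\<chi> i. 1}"
      by simp
  qed
  then show ?thesis
    using wf_digraph.all_sccs_trivial_iff_acyclic[OF wf_digraph_dependency_graph, of f] by simp
qed

end
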